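(* Let $A=(a_{ij})_{1\le i,j\le n}$ be an ASSR matrix with signature $\varepsilon=(\varepsilon_1,\dots,\varepsilon_n)$ and let $C(A)=(c_{ij})$ be its combined matrix. If $A$ is type-I staircase, then $C(A)$ is also type-I staircase.
   Context: The combined matrix of a nonsingular real matrix $A$ is $C(A)=A\circ (A^{-1})^T$ (Hadamard product). For $\alpha,\beta\in Q_{m,n}$ (increasing sequences of $m$ integers in $\{1,\dots,n\}$), $A[\alpha|\beta]$ is the submatrix with rows $\alpha$ and columns $\beta$. A real matrix $A=(a_{ij})$ is type-I staircase if: (i) $a_{ii}\neq 0$ for all $i$; (ii) if $a_{ij}=0$ with $i>j$, then $a_{kl}=0$ for all $l\le j$, $k\ge i$; (iii) if $a_{ij}=0$ with $i<j$, then $a_{kl}=0$ for all $k\le i$, $l\ge j$. It is type-II staircase if: (i) $a_{i,n-i+1}\neq 0$ for all $i$; (ii) if $a_{ij}=0$ with $j>n-i+1$, then $a_{kl}=0$ for all $k\ge i$, $l\ge j$; (iii) if $a_{ij}=0$ with $j<n-i+1$, then $a_{kl}=0$ for all $k\le i$, $l\le j$. For a type-I (resp. type-II) staircase matrix, $A[\alpha|\beta]$ is nontrivial if $a_{\alpha_i\beta_i}\neq0$ (resp. $a_{\alpha_i\beta_{m-i+1}}\neq 0$) for all $i$. $A$ is ASSR with signature $\varepsilon\in\{\pm1\}^n$ if it is type-I or type-II staircase and $\varepsilon_m\det A[\alpha|\beta]>0$ for every nontrivial submatrix of order $m$ (ASSR matrices are nonsingular). *)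

theory Defs
  imports
    Complex_Main
    "Jordan_Normal_Form.Determinant"
    "Jordan_Normal_Form.Gauss_Jordan_Elimination"
    "Jordan_Normal_Form.DL_Submatrix"
begin

text \<open>
  Rows and columns are numbered from 0, so the antidiagonal position \<open>(i, n - i + 1)\<close> of the
  usual 1-based numbering becomes \<open>(i, n - 1 - i)\<close>. Orders of minors, and hence the index
  of the signature, keep their usual values \<open>1, \<dots>, n\<close>.
\<close>

definition hadamard_prod :: "real mat \<Rightarrow> real mat \<Rightarrow> real mat" where
  "hadamard_prod A B = mat (dim_row A) (dim_col A) (\<lambda>(i, j). A $$ (i, j) * B $$ (i, j))"

text \<open>Meaningful for nonsingular \<open>A\<close> only; otherwise \<open>mat_inverse A\<close> is \<open>None\<close>.\<close>

definition combined_matrix :: "real mat \<Rightarrow> real mat" where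
  "combined_matrix A = hadamard_prod A (transpose_mat (the (mat_inverse A)))"

definition Q :: "nat \<Rightarrow> nat \<Rightarrow> nat list set" where
  "Q m n = {\<alpha>. length \<alpha> = m \<and> sorted_wrt (<) \<alpha> \<and> set \<alpha> \<subseteq> {..<n}}"

definition submat :: "real mat \<Rightarrow> nat list \<Rightarrow> nat list \<Rightarrow> real mat" where
  "submat A \<alpha> \<beta> = submatrix A (set \<alpha>) (set \<beta>)"

definition type_I_staircase :: "nat \<Rightarrow> real mat \<Rightarrow> bool" where
  "type_I_staircase n A \<longleftrightarrow>
     A \<in> carrier_mat n n \<and>
     (\<forall>i<n. A $$ (i, i) \<noteq> 0) \<and>
     (\<forall>i<n. \<forall>j<n. i > j \<and> A $$ (i, j) = 0 \<longrightarrow>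
        (\<forall>k<n. \<forall>l<n. l \<le> j \<and> k \<ge> i \<longrightarrow> A $$ (k, l) = 0)) \<and>
     (\<forall>i<n. \<forall>j<n. i < j \<and> A $$ (i, j) = 0 \<longrightarrow>
        (\<forall>k<n. \<forall>l<n. k \<le> i \<and> l \<ge> j \<longrightarrow> A $$ (k, l) = 0))"

definition type_II_staircase :: "nat \<Rightarrow> real mat \<Rightarrow> bool" where
  "type_II_staircase n A \<longleftrightarrow>
     A \<in> carrier_mat n n \<and>
     (\<forall>i<n. A $$ (i, n - 1 - i) \<noteq> 0) \<and>
     (\<forall>i<n. \<forall>j<n. j > n - 1 - i \<and> A $$ (i, j) = 0 \<longrightarrow>
        (\<forall>k<n. \<forall>l<n. k \<ge> i \<and> l \<ge> j \<longrightarrow> A $$ (k, l) = 0)) \<and>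
     (\<forall>i<n. \<forall>j<n. j < n - 1 - i \<and> A $$ (i, j) = 0 \<longrightarrow>
        (\<forall>k<n. \<forall>l<n. k \<le> i \<and> l \<le> j \<longrightarrow> A $$ (k, l) = 0))"

definition nontrivial_I :: "real mat \<Rightarrow> nat list \<Rightarrow> nat list \<Rightarrow> bool" where
  "nontrivial_I A \<alpha> \<beta> \<longleftrightarrow> (\<forall>i<length \<alpha>. A $$ (\<alpha> ! i, \<beta> ! i) \<noteq> 0)"

definition nontrivial_II :: "real mat \<Rightarrow> nat list \<Rightarrow> nat list \<Rightarrow> bool" where
  "nontrivial_II A \<alpha> \<beta> \<longleftrightarrow>
     (\<forall>i<length \<alpha>. A $$ (\<alpha> ! i, \<beta> ! (length \<alpha> - 1 - i)) \<noteq> 0)"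

definition ASSR :: "nat \<Rightarrow> (nat \<Rightarrow> real) \<Rightarrow> real mat \<Rightarrow> bool" where
  "ASSR n \<epsilon> A \<longleftrightarrow>
     (\<forall>m\<in>{1..n}. \<epsilon> m \<in> {-1, 1}) \<and>
     (type_I_staircase n A \<and>
        (\<forall>m\<in>{1..n}. \<forall>\<alpha>\<in>Q m n. \<forall>\<beta>\<in>Q m n.
           nontrivial_I A \<alpha> \<beta> \<longrightarrow> \<epsilon> m * det (submat A \<alpha> \<beta>) > 0)
      \<or> type_II_staircase n A \<and>
        (\<forall>m\<in>{1..n}. \<forall>\<alpha>\<in>Q m n. \<forall>\<beta>\<in>Q m n.
           nontrivial_II A \<alpha> \<beta> \<longrightarrow> \<epsilon> m * det (submat A \<alpha> \<beta>) > 0))"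

lemma pick_set_eq_nth:
  assumes "sorted_wrt (<) \<alpha>" and "i < length \<alpha>"
  shows "pick (set \<alpha>) i = \<alpha> ! i"
proof -
  have inj: "inj_on ((!) \<alpha>) {..<i}"
    using assms by (intro inj_on_nth) (auto simp: strict_sorted_iff)
  have "{a \<in> set \<alpha>. a < \<alpha> ! i} = (!) \<alpha> ` {..<i}"
  proof (intro equalityI subsetI)
    fix a assume "a \<in> {a \<in> set \<alpha>. a < \<alpha> ! i}"
    then obtain k where k: "k < length \<alpha>" "a = \<alpha> ! k" "\<alpha> ! k < \<alpha> ! i"
      by (auto simp: in_set_conv_nth)
    have "k < i"
    proof (rule ccontr)
      assume "\<not> k < i"
      then have "\<alpha> ! i \<le> \<alpha> ! k"
        using assms k(1) by (cases "i = k") (auto simp: sorted_wrt_iff_nth_less intro!: less_imp_le)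
      then show False using k(3) by simp
    qed
    then show "a \<in> (!) \<alpha> ` {..<i}" using k(2) by blast
  next
    fix a assume "a \<in> (!) \<alpha> ` {..<i}"
    then show "a \<in> {a \<in> set \<alpha>. a < \<alpha> ! i}"
      using assms by (auto simp: sorted_wrt_iff_nth_less)
  qed
  then have "card {a \<in> set \<alpha>. a < \<alpha> ! i} = i"
    using card_image[OF inj] by simp
  moreover have "pick (set \<alpha>) (card {a \<in> set \<alpha>. a < \<alpha> ! i}) = \<alpha> ! i"
    using assms(2) by (intro pick_card_in_set) simp
  ultimately show ?thesis by simp
qed

lemma submat_eq:
  assumes "A \<in> carrier_mat n n" and "\<alpha> \<in> Q m n" and "\<beta> \<in> Q m n"
  shows "submat A \<alpha> \<beta> = mat m m (\<lambda>(i, j). A $$ (\<alpha> ! i, \<beta> ! j))"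
proof -
  have "card {i. i < n \<and> i \<in> set \<gamma>} = m" if "\<gamma> \<in> Q m n" for \<gamma>
  proof -
    have "{i. i < n \<and> i \<in> set \<gamma>} = set \<gamma>" using that by (auto simp: Q_def)
    moreover have "card (set \<gamma>) = m"
      using that by (auto simp: Q_def strict_sorted_iff distinct_card)
    ultimately show ?thesis by simp
  qed
  then show ?thesis
    using assms unfolding submat_def submatrix_def
    by (intro eq_matI) (auto simp: Q_def pick_set_eq_nth)
qed

end

theory Submission
  imports Defs
begin

text \<open>
  Up to sign and the factor \<open>det A\<close>, the entry \<open>c\<^bsub>ij\<^esub>\<close> is \<open>a\<^bsub>ij\<^esub>\<close> times the minor that omits row \<open>i\<close>
  and column \<open>j\<close>. For \<open>i \<ge> j\<close> the diagonal of that minor consists of diagonal entries of \<open>A\<close> and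
  of the superdiagonal entries \<open>a\<^bsub>t,t+1\<^esub>\<close> with \<open>j \<le> t < i\<close>. If all of these are nonzero, the minor
  is nontrivial, hence nonzero; if one of them vanishes, the staircase shape produces a zero block
  too large for a nonsingular matrix. So the minor vanishes iff some \<open>a\<^bsub>t,t+1\<^esub>\<close> with
  \<open>j \<le> t < i\<close> does, a condition that persists when \<open>i\<close> grows and \<open>j\<close> shrinks. The upper
  triangle follows by transposition. A matrix that is staircase of both types has no zero entry,
  so for it the two notions of nontriviality agree.
\<close>

text \<open>The sign-free consequence of the ASSR condition on which the argument runs; unlike
  \<open>ASSR\<close>, it refers to type-I nontriviality alone. Order 0 is harmless, as the empty
  determinant is 1.\<close>

definition nontrivial_minors_nonzero :: "nat \<Rightarrow> real mat \<Rightarrow> bool" where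
  "nontrivial_minors_nonzero n A \<longleftrightarrow>
     (\<forall>m. \<forall>\<alpha>\<in>Q m n. \<forall>\<beta>\<in>Q m n. nontrivial_I A \<alpha> \<beta> \<longrightarrow> det (submat A \<alpha> \<beta>) \<noteq> 0)"

section \<open>Staircase shape and transposition\<close>

lemma type_I_staircase_carrier: "type_I_staircase n A \<Longrightarrow> A \<in> carrier_mat n n"
  unfolding type_I_staircase_def by blast

lemma type_I_staircase_diag: "type_I_staircase n A \<Longrightarrow> i < n \<Longrightarrow> A $$ (i, i) \<noteq> 0"
  unfolding type_I_staircase_def by (drule conjunct2, drule conjunct1) simp

lemma type_I_staircase_lower:
  assumes "type_I_staircase n A" "A $$ (i, j) = 0" "j < i" "l \<le> j" "i \<le> k" "k < n"
  shows "A $$ (k, l) = 0"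
proof -
  have "i < n" "j < n" "l < n" using assms by auto
  with assms(2-)
    assms(1)[unfolded type_I_staircase_def, THEN conjunct2, THEN conjunct2, THEN conjunct1]
  show ?thesis by blast
qed

lemma type_I_staircase_upper:
  assumes "type_I_staircase n A" "A $$ (i, j) = 0" "i < j" "k \<le> i" "j \<le> l" "l < n"
  shows "A $$ (k, l) = 0"
proof -
  have "i < n" "j < n" "k < n" using assms by auto
  with assms(2-)
    assms(1)[unfolded type_I_staircase_def, THEN conjunct2, THEN conjunct2, THEN conjunct2]
  show ?thesis by blast
qed

lemma type_I_staircase_transpose:
  assumes "type_I_staircase n A"
  shows "type_I_staircase n (transpose_mat A)"
proof -
  have A: "A \<in> carrier_mat n n" using assms by (rule type_I_staircase_carrier)
  show ?thesis
    unfolding type_I_staircase_def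
  proof (intro conjI allI impI)
    show "transpose_mat A \<in> carrier_mat n n" using A by simp
  next
    fix i assume "i < n"
    then show "transpose_mat A $$ (i, i) \<noteq> 0"
      using A type_I_staircase_diag[OF assms] by simp
  next
    fix i j k l
    assume "i < n" "j < n" "j < i \<and> transpose_mat A $$ (i, j) = 0" "k < n" "l < n" "l \<le> j \<and> i \<le> k"
    then show "transpose_mat A $$ (k, l) = 0"
      using A type_I_staircase_upper[OF assms, of j i l k] by auto
  next
    fix i j k l
    assume "i < n" "j < n" "i < j \<and> transpose_mat A $$ (i, j) = 0" "k < n" "l < n" "k \<le> i \<and> j \<le> l"
    then show "transpose_mat A $$ (k, l) = 0"
      using A type_I_staircase_lower[OF assms, of j i k l] by auto
  qed
qed

lemma Q_nth_less: "\<alpha> \<in> Q m n \<Longrightarrow> i < m \<Longrightarrow> \<alpha> ! i < n"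
  using nth_mem[of i \<alpha>] by (auto simp: Q_def subset_iff)

lemma nontrivial_minors_nonzero_transpose:
  assumes "A \<in> carrier_mat n n" "nontrivial_minors_nonzero n A"
  shows "nontrivial_minors_nonzero n (transpose_mat A)"
  unfolding nontrivial_minors_nonzero_def
proof (intro allI ballI impI)
  fix m \<alpha> \<beta>
  assume \<alpha>: "\<alpha> \<in> Q m n" and \<beta>: "\<beta> \<in> Q m n" and nt: "nontrivial_I (transpose_mat A) \<alpha> \<beta>"
  have len: "length \<alpha> = m" "length \<beta> = m" using \<alpha> \<beta> by (auto simp: Q_def)
  have "nontrivial_I A \<beta> \<alpha>"
    using nt len assms(1) Q_nth_less[OF \<alpha>] Q_nth_less[OF \<beta>] by (auto simp: nontrivial_I_def)
  then have "det (submat A \<beta> \<alpha>) \<noteq> 0"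
    using assms(2) \<alpha> \<beta> unfolding nontrivial_minors_nonzero_def by blast
  moreover have "submat (transpose_mat A) \<alpha> \<beta> = transpose_mat (submat A \<beta> \<alpha>)"
    using assms(1) Q_nth_less[OF \<alpha>] Q_nth_less[OF \<beta>]
    by (intro eq_matI) (auto simp: submat_eq[OF _ \<alpha> \<beta>] submat_eq[OF _ \<beta> \<alpha>])
  moreover have "submat A \<beta> \<alpha> \<in> carrier_mat m m"
    using assms(1) by (simp add: submat_eq[OF _ \<beta> \<alpha>])
  ultimately show "det (submat (transpose_mat A) \<alpha> \<beta>) \<noteq> 0"
    by (simp add: det_transpose)
qed

section \<open>Vanishing of cofactors\<close>

text \<open>Since \<open>(t + 1) + (m - t) > m\<close>, every permutation meets the zero block.\<close>

lemma det_eq_0_if_zero_block: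
  fixes B :: "'a :: comm_ring_1 mat"
  assumes B: "B \<in> carrier_mat m m" and "t < m"
    and zero: "\<And>i j. i \<le> t \<Longrightarrow> t \<le> j \<Longrightarrow> j < m \<Longrightarrow> B $$ (i, j) = 0"
  shows "det B = 0"
proof -
  have "(\<Prod>i = 0..<m. B $$ (i, p i)) = 0" if p: "p permutes {0..<m}" for p
  proof -
    have "\<not> p ` {0..t} \<subseteq> {0..<t}"
    proof
      assume "p ` {0..t} \<subseteq> {0..<t}"
      then have "card (p ` {0..t}) \<le> t" using card_mono[of "{0..<t}"] by fastforce
      moreover have "card (p ` {0..t}) = Suc t"
        using card_image[OF permutes_inj_on[OF p], of "{0..t}"] by simp
      ultimately show False by simp
    qed
    then obtain i where "i \<le> t" "t \<le> p i" by fastforce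
    moreover from this have "p i < m" using permutes_in_image[OF p, of i] \<open>t < m\<close> by simp
    ultimately show ?thesis
      using zero[of i "p i"] \<open>t < m\<close> by (intro prod_zero bexI[of _ i]) auto
  qed
  then show ?thesis by (simp add: det_def'[OF B])
qed

text \<open>\<open>insert_index i\<close> enumerates the indices other than \<open>i\<close> in
  increasing order. This turns cofactor minors into submatrices to which nontriviality
  applies.\<close>

lemma mat_delete_eq_submat:
  assumes "A \<in> carrier_mat n n" "i < n" "j < n"
  defines "\<delta> \<equiv> \<lambda>i. map (insert_index i) [0..<n - 1]"
  shows "mat_delete A i j = submat A (\<delta> i) (\<delta> j)" "\<delta> i \<in> Q (n - 1) n" "\<delta> j \<in> Q (n - 1) n"
proof -
  have \<delta>: "\<delta> i \<in> Q (n - 1) n" for i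
    by (auto simp: \<delta>_def Q_def sorted_wrt_iff_nth_less insert_index_def)
  then show "\<delta> i \<in> Q (n - 1) n" "\<delta> j \<in> Q (n - 1) n" by auto
  show "mat_delete A i j = submat A (\<delta> i) (\<delta> j)"
    using assms(1) unfolding submat_eq[OF assms(1) \<delta> \<delta>]
    by (intro eq_matI) (auto simp: mat_delete_def \<delta>_def insert_index_def)
qed

lemma cofactor_lower_eq_0_iff:
  assumes st: "type_I_staircase n A" and nz: "nontrivial_minors_nonzero n A"
    and "j \<le> i" "i < n"
  shows "cofactor A i j = 0 \<longleftrightarrow> (\<exists>t. j \<le> t \<and> t < i \<and> A $$ (t, Suc t) = 0)"
proof
  have A: "A \<in> carrier_mat n n" using st by (rule type_I_staircase_carrier)
  {
    assume "\<exists>t. j \<le> t \<and> t < i \<and> A $$ (t, Suc t) = 0"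
    then obtain t where t: "j \<le> t" "t < i" "A $$ (t, Suc t) = 0" by blast
    have "det (mat_delete A i j) = 0"
    proof (rule det_eq_0_if_zero_block)
      show "mat_delete A i j \<in> carrier_mat (n - 1) (n - 1)"
        using A by (rule mat_delete_carrier)
      show "t < n - 1" using t \<open>i < n\<close> by simp
      fix p q assume pq: "p \<le> t" "t \<le> q" "q < n - 1"
      \<comment> \<open>Since \<open>p \<le> t < i\<close>, row \<open>p\<close> of the minor is row
        \<open>p\<close> of \<open>A\<close>; since \<open>j \<le> t \<le> q\<close>, its column
        \<open>q\<close> is column \<open>q + 1\<close> of \<open>A\<close>. The zero at
        \<open>(t, t + 1)\<close> spreads up and right over this block.\<close>
      then have "A $$ (p, Suc q) = 0"
        using type_I_staircase_upper[OF st t(3)] by simp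
      then show "mat_delete A i j $$ (p, q) = 0"
        using A pq t \<open>i < n\<close> by (simp add: mat_delete_def)
    qed
    then show "cofactor A i j = 0" by (simp add: cofactor_def)
  }
  {
    assume "cofactor A i j = 0"
    then have "det (mat_delete A i j) = 0" by (simp add: cofactor_def)
    then have "\<not> nontrivial_I A (map (insert_index i) [0..<n - 1]) (map (insert_index j) [0..<n - 1])"
      using mat_delete_eq_submat[OF A, of i j] assms(2-) unfolding nontrivial_minors_nonzero_def
      by force
    then obtain t where t: "t < n - 1" "A $$ (insert_index i t, insert_index j t) = 0"
      by (auto simp: nontrivial_I_def)
    moreover have "t < n" "Suc t < n" using t(1) by auto
    ultimately show "\<exists>t. j \<le> t \<and> t < i \<and> A $$ (t, Suc t) = 0"
      \<comment> \<open>The minor has diagonal entry \<open>A $$ (t, t)\<close> for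
        \<open>t < j\<close>, \<open>A $$ (t, t + 1)\<close> for \<open>j \<le> t < i\<close>, and
        \<open>A $$ (t + 1, t + 1)\<close> for \<open>i \<le> t\<close>; only the middle kind can
        vanish.\<close>
      using \<open>j \<le> i\<close> type_I_staircase_diag[OF st, of t] type_I_staircase_diag[OF st, of "Suc t"]
      by (intro exI[of _ t]) (auto simp: insert_index_def split: if_splits)
  }
qed

section \<open>Entries of the combined matrix\<close>

lemma combined_matrix_entry:
  assumes A: "A \<in> carrier_mat n n" and "det A \<noteq> 0" "i < n" "j < n"
  shows "combined_matrix A $$ (i, j) = A $$ (i, j) * cofactor A i j / det A"
proof -
  have "A \<in> Units (ring_mat TYPE(real) n ())"
    using det_non_zero_imp_unit[OF A \<open>det A \<noteq> 0\<close>] .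
  then obtain B where B: "mat_inverse A = Some B"
    using mat_inverse(1)[OF A, of "()"] by (cases "mat_inverse A") auto
  then have BA: "B * A = 1\<^sub>m n" and Bc: "B \<in> carrier_mat n n"
    using mat_inverse(2)[OF A] by auto
  \<comment> \<open>The adjugate identifies the inverse \<open>B\<close> entrywise. Its built-in
    transposition cancels the one in \<open>combined_matrix\<close>, so the cofactor appears at
    \<open>(i, j)\<close>.\<close>
  have "adj_mat A = (B * A) * adj_mat A" using BA adj_mat(1)[OF A] by simp
  also have "\<dots> = B * (A * adj_mat A)" using A Bc adj_mat(1)[OF A] by (rule_tac assoc_mult_mat)
  also have "\<dots> = det A \<cdot>\<^sub>m B" 
    using Bc by (simp add: adj_mat(2)[OF A] mult_smult_distrib[OF Bc one_carrier_mat])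
  finally have "adj_mat A $$ (j, i) = det A * B $$ (j, i)" using Bc assms by simp
  then have "cofactor A i j = det A * B $$ (j, i)" using assms by (simp add: adj_mat_def)
  then show ?thesis
    using A Bc B assms by (simp add: combined_matrix_def hadamard_prod_def)
qed

text \<open>\<open>A\<close> is itself a nontrivial submatrix, by its nonzero diagonal.\<close>

lemma det_nonzero_if_nontrivial_minors_nonzero:
  assumes st: "type_I_staircase n A" and nz: "nontrivial_minors_nonzero n A"
  shows "det A \<noteq> 0"
proof -
  have A: "A \<in> carrier_mat n n" using st by (rule type_I_staircase_carrier)
  have Q: "[0..<n] \<in> Q n n" by (auto simp: Q_def)
  moreover have "nontrivial_I A [0..<n] [0..<n]"
    using type_I_staircase_diag[OF st] by (simp add: nontrivial_I_def)
  moreover have "submat A [0..<n] [0..<n] = A"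
    using A by (intro eq_matI) (auto simp: submat_eq[OF A Q Q])
  ultimately show ?thesis using nz unfolding nontrivial_minors_nonzero_def by metis
qed

lemma type_I_staircase_combined_matrix:
  assumes st: "type_I_staircase n A" and nz: "nontrivial_minors_nonzero n A"
  shows "type_I_staircase n (combined_matrix A)"
proof -
  have A: "A \<in> carrier_mat n n" using st by (rule type_I_staircase_carrier)
  have st': "type_I_staircase n (transpose_mat A)"
    and nz': "nontrivial_minors_nonzero n (transpose_mat A)"
    using type_I_staircase_transpose[OF st] nontrivial_minors_nonzero_transpose[OF A nz] by auto
  have c: "combined_matrix A $$ (i, j) = 0 \<longleftrightarrow> A $$ (i, j) = 0 \<or> cofactor A i j = 0"
    if "i < n" "j < n" for i j
    using combined_matrix_entry[OF A _ that] det_nonzero_if_nontrivial_minors_nonzero[OF st nz]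
    by simp
  have cof': "cofactor (transpose_mat A) j i = cofactor A i j" if "i < n" "j < n" for i j
  proof -
    have "mat_delete (transpose_mat A) j i = transpose_mat (mat_delete A i j)"
      using that A by (intro eq_matI) (auto simp: mat_delete_def)
    then show ?thesis
      by (simp add: cofactor_def det_transpose[OF mat_delete_carrier[OF A]] add.commute)
  qed
  show ?thesis
    unfolding type_I_staircase_def
  proof (intro conjI allI impI)
    show "combined_matrix A \<in> carrier_mat n n"
      using A by (simp add: combined_matrix_def hadamard_prod_def)
  next
    fix i assume "i < n"
    then show "combined_matrix A $$ (i, i) \<noteq> 0"
      \<comment> \<open>For \<open>j = i\<close> the range \<open>j \<le> t < i\<close> is empty, so
        the diagonal cofactors are nonzero.\<close>
      using c type_I_staircase_diag[OF st] cofactor_lower_eq_0_iff[OF st nz, of i i] by simp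
  next
    fix i j k l
    assume "i < n" "j < n" "j < i \<and> combined_matrix A $$ (i, j) = 0" "k < n" "l < n" "l \<le> j \<and> i \<le> k"
    then have le: "j < i" "l \<le> j" "i \<le> k" and "A $$ (i, j) = 0 \<or> cofactor A i j = 0"
      and kl: "k < n" "l < n" and "i < n"
      using c[of i j] by auto
    then consider "A $$ (i, j) = 0" | t where "j \<le> t" "t < i" "A $$ (t, Suc t) = 0"
      using cofactor_lower_eq_0_iff[OF st nz, of j i] by auto
    \<comment> \<open>Each cause of a zero persists: a zero of \<open>A\<close> by its staircase
      shape, a vanishing cofactor because the range from \<open>l\<close> to \<open>k\<close>
      contains that from \<open>j\<close> to \<open>i\<close>.\<close>
    then have "A $$ (k, l) = 0 \<or> cofactor A k l = 0"
    proof cases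
      case 1
      then show ?thesis using type_I_staircase_lower[OF st] le kl by blast
    next
      case (2 t)
      then have "l \<le> t" "t < k" using le by auto
      then show ?thesis using 2 kl cofactor_lower_eq_0_iff[OF st nz, of l k] by auto
    qed
    then show "combined_matrix A $$ (k, l) = 0" using c[OF kl] by simp
  next
    fix i j k l
    assume "i < n" "j < n" "i < j \<and> combined_matrix A $$ (i, j) = 0" "k < n" "l < n" "k \<le> i \<and> j \<le> l"
    then have le: "i < j" "k \<le> i" "j \<le> l" and "A $$ (i, j) = 0 \<or> cofactor (transpose_mat A) j i = 0"
      and kl: "k < n" "l < n" and "j < n"
      using c[of i j] cof'[of i j] by auto
    \<comment> \<open>The witness is now the subdiagonal entry of \<open>A\<close> at
      \<open>(t + 1, t)\<close>.\<close>
    then consider "A $$ (i, j) = 0" | t where "i \<le> t" "t < j" "transpose_mat A $$ (t, Suc t) = 0"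
      using cofactor_lower_eq_0_iff[OF st' nz', of i j] by auto
    then have "A $$ (k, l) = 0 \<or> cofactor A k l = 0"
    proof cases
      case 1
      then show ?thesis using type_I_staircase_upper[OF st] le kl by blast
    next
      case (2 t)
      then have "k \<le> t" "t < l" using le by auto
      then have "cofactor (transpose_mat A) l k = 0"
        using 2 kl cofactor_lower_eq_0_iff[OF st' nz', of k l] by auto
      then show ?thesis using cof'[OF kl] by simp
    qed
    then show "combined_matrix A $$ (k, l) = 0" using c[OF kl] by simp
  qed
qed

section \<open>From ASSR to nonvanishing minors\<close>

lemma nonzero_if_both_staircase:
  assumes I: "type_I_staircase n A" and II: "type_II_staircase n A" and "i < n" "j < n"
  shows "A $$ (i, j) \<noteq> 0"
proof
  assume z: "A $$ (i, j) = 0"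
  have anti: "A $$ (k, n - 1 - k) \<noteq> 0" if "k < n" for k
    using II[unfolded type_II_staircase_def, THEN conjunct2, THEN conjunct1] that by simp
  show False
  \<comment> \<open>An off-diagonal zero would spread to the top right or bottom left corner, which
    lies on the antidiagonal.\<close>
  proof (cases i j rule: linorder_cases)
    case less
    then show ?thesis
      using type_I_staircase_upper[OF I z, of 0 "n - 1"] anti[of 0] assms by simp
  next
    case equal
    then show ?thesis using z type_I_staircase_diag[OF I] assms by simp
  next
    case greater
    then show ?thesis
      using type_I_staircase_lower[OF I z, of 0 "n - 1"] anti[of "n - 1"] assms by simp
  qed
qed

lemma ASSR_nontrivial_minors_nonzero:
  assumes ASSR: "ASSR n \<epsilon> A" and I: "type_I_staircase n A"
  shows "nontrivial_minors_nonzero n A"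
  unfolding nontrivial_minors_nonzero_def
proof (intro allI ballI impI)
  fix m \<alpha> \<beta>
  assume \<alpha>: "\<alpha> \<in> Q m n" and \<beta>: "\<beta> \<in> Q m n" and nt: "nontrivial_I A \<alpha> \<beta>"
  have A: "A \<in> carrier_mat n n" using I by (rule type_I_staircase_carrier)
  show "det (submat A \<alpha> \<beta>) \<noteq> 0"
  proof (cases "m = 0")
    case True
    then show ?thesis using submat_eq[OF A \<alpha> \<beta>] by (simp add: det_dim_zero)
  next
    case False
    have "distinct \<alpha>" "set \<alpha> \<subseteq> {..<n}" "length \<alpha> = m" "length \<beta> = m"
      using \<alpha> \<beta> by (auto simp: Q_def strict_sorted_iff)
    then have "m \<le> n" using card_mono[of "{..<n}" "set \<alpha>"] by (simp add: distinct_card)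
    with False have m: "m \<in> {1..n}" by simp
    \<comment> \<open>The sign condition in \<open>ASSR\<close> may come from its type-II branch;
      then \<open>A\<close> has no zero entry and the submatrix is nontrivial in that sense
      too.\<close>
    have "nontrivial_II A \<alpha> \<beta>" if "type_II_staircase n A"
      using nonzero_if_both_staircase[OF I that] Q_nth_less[OF \<alpha>] Q_nth_less[OF \<beta>] \<open>length \<alpha> = m\<close>
      by (simp add: nontrivial_II_def)
    then have "\<epsilon> m * det (submat A \<alpha> \<beta>) > 0"
      using ASSR m \<alpha> \<beta> nt unfolding ASSR_def by metis
    then show ?thesis by auto
  qed
qed

theorem theorem3:
  fixes n :: nat and A :: "real mat" and \<epsilon> :: "nat \<Rightarrow> real"
  assumes "ASSR n \<epsilon> A"
    and "type_I_staircase n A"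
  shows "type_I_staircase n (combined_matrix A)"
  using type_I_staircase_combined_matrix[OF assms(2) ASSR_nontrivial_minors_nonzero[OF assms]] .

end
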